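(* For integers $n \ge 2$ the function $\nu_{\infty}(\overline{G}_n) := \log(\overline{G}_n)$ satisfies $$\log(\overline{G}_n) = \frac{1}{2} n^2 - \frac{1}{2} n \log n + \left(1 - \frac{1}{2}\log(2\pi)\right) n + O(\log n).$$ (Here $1-\frac12\log(2\pi) \approx 0.08106$.)
   Context: $\overline{G}_n := \prod_{k=0}^n \binom{n}{k}$ is the product of the binomial coefficients in the $n$-th row of Pascal's triangle. The implied constant in the $O$-term is absolute. *)

theory Defs
  imports Complex_Main
begin

definition binomial_row_product :: "nat \<Rightarrow> nat" where
  "binomial_row_product n = (\<Prod>k=0..n. n choose k)"

end

theory Submission
  imports Defs "HOL-Analysis.Analysis" "HOL-Real_Asymp.Real_Asymp"
begin

text \<open>
  Write \<open>G n\<close> for the row product. Passing from row \<open>n\<close> to row \<open>n + 1\<close> multiplies the entry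
  \<open>n choose k\<close> by \<open>(n + 1) / (n + 1 - k)\<close>, so that \<open>G (n + 1) / G n = (n + 1) ^ n / n!\<close>.
  By Stirling's formula with relative error \<open>O(1 / n)\<close>, the logarithm of this ratio differs from the
  increment of the claimed main term by only \<open>O(1 / n)\<close>, and summing these errors gives the
  \<open>O(log n)\<close>.

  The form of Stirling's formula that this needs is
  \<open>0 \<le> ln n! - ((n + 1/2) ln n - n + ln (2 pi) / 2) \<le> 1 / (4 n)\<close>. It comes from the two elementary
  bounds of \<open>ln (n + 1) - ln n\<close>, the integral of \<open>1 / x\<close>, by the midpoint rule (below) and by the
  trapezoid rule (above): they make the remainder \<open>ln n! - (n + 1/2) ln n + n\<close> decreasing and
  the remainder minus \<open>1 / (4 n)\<close> increasing, hence both convergent to the same limit, which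
  Wallis' product identifies.

  In the final summation the constants work out well: each error is at most
  \<open>1 / (2 n) \<le> 1 / (n + 1) \<le> ln (n + 1) - ln n\<close>, so that the errors telescope against \<open>ln n\<close>.
\<close>

section \<open>Stirling's formula with an explicit error\<close>

definition stirling_remainder :: "nat \<Rightarrow> real" where
  "stirling_remainder n = ln (fact n) - (real n + 1 / 2) * ln (real n) + real n"

text \<open>
  The two bounds are the midpoint and trapezoid rules for \<open>1 / x\<close> on \<open>[n, n + 1]\<close>, scaled by \<open>n + 1/2\<close>.
  The excess \<open>1 / (4 n (n + 1))\<close> is split into partial fractions so that it telescopes.
\<close>

lemma ln_increment_bounds:
  fixes n :: nat
  assumes "n > 0"
  shows "1 \<le> (real n + 1 / 2) * (ln (real n + 1) - ln (real n))"
    and "(real n + 1 / 2) * (ln (real n + 1) - ln (real n)) \<le> 1 + (1 / (4 * real n) - 1 / (4 * (real n + 1)))"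
proof -
  let ?x = "real n"
  have pos: "?x > 0" using assms by simp
  have "2 / (2 * ?x + 1) \<le> ln (?x + 1) - ln ?x"
    using ln_inverse_approx_ge[of ?x "?x + 1"] pos by (simp add: add_ac)
  hence "(?x + 1 / 2) * (2 / (2 * ?x + 1)) \<le> (?x + 1 / 2) * (ln (?x + 1) - ln ?x)"
    using pos by (intro mult_left_mono) auto
  moreover have "(?x + 1 / 2) * (2 / (2 * ?x + 1)) = 1"
    using pos by (simp add: field_simps)
  ultimately show "1 \<le> (?x + 1 / 2) * (ln (?x + 1) - ln ?x)" by (simp only:)
  have "ln (?x + 1) - ln ?x \<le> (1 / ?x + 1 / (?x + 1)) / 2"
    using ln_inverse_approx_le[of ?x 1] pos by (simp add: inverse_eq_divide)
  hence "(?x + 1 / 2) * (ln (?x + 1) - ln ?x) \<le> (?x + 1 / 2) * ((1 / ?x + 1 / (?x + 1)) / 2)"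
    using pos by (intro mult_left_mono) auto
  also have "\<dots> = 1 + (1 / (4 * ?x) - 1 / (4 * (?x + 1)))"
    using pos by (simp add: divide_simps) (simp add: algebra_simps)
  finally show "(?x + 1 / 2) * (ln (?x + 1) - ln ?x) \<le> 1 + (1 / (4 * ?x) - 1 / (4 * (?x + 1)))" .
qed

lemma ln_fact_Suc: "ln (fact (Suc n) :: real) = ln (real n + 1) + ln (fact n)"
  by (simp add: ln_mult add_ac)

lemma stirling_remainder_Suc:
  "stirling_remainder n - stirling_remainder (Suc n) =
     (real n + 1 / 2) * (ln (real n + 1) - ln (real n)) - 1"
  unfolding stirling_remainder_def ln_fact_Suc by (simp add: algebra_simps)

lemma decseq_stirling_remainder: "decseq (\<lambda>n. stirling_remainder (Suc n))"
proof (rule decseq_SucI)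
  fix n
  show "stirling_remainder (Suc (Suc n)) \<le> stirling_remainder (Suc n)"
    using stirling_remainder_Suc[of "Suc n"] ln_increment_bounds(1)[of "Suc n"] by simp
qed

lemma incseq_stirling_remainder:
  "incseq (\<lambda>n. stirling_remainder (Suc n) - 1 / (4 * real (Suc n)))"
proof (rule incseq_SucI)
  fix n
  have "stirling_remainder (Suc n) - stirling_remainder (Suc (Suc n))
          \<le> 1 / (4 * real (Suc n)) - 1 / (4 * real (Suc (Suc n)))"
    using stirling_remainder_Suc[of "Suc n"] ln_increment_bounds(2)[of "Suc n"]
    by (simp add: add_ac)
  thus "stirling_remainder (Suc n) - 1 / (4 * real (Suc n))
          \<le> stirling_remainder (Suc (Suc n)) - 1 / (4 * real (Suc (Suc n)))"
    by simp
qed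

lemma wallis_prod_eq_fact:
  "(\<Prod>k=1..n. (4 * real k ^ 2) / (4 * real k ^ 2 - 1)) =
     16 ^ n * fact n ^ 4 / (fact (2 * n) ^ 2 * (2 * real n + 1))"
proof (induction n)
  case (Suc n)
  have "4 * real (Suc n) ^ 2 - 1 = (2 * real n + 1) * (2 * real n + 3)"
    by (simp add: power2_eq_square algebra_simps)
  moreover have "fact (2 * Suc n) = (2 * real n + 2) * (2 * real n + 1) * fact (2 * n)"
    by (simp add: algebra_simps)
  moreover have "fact (Suc n) = (real n + 1) * fact n" by (simp add: algebra_simps)
  moreover have "q * f ^ 4 / (F ^ 2 * a) * ((4 * y ^ 2) / (a * b)) =
      (16 * q) * (y * f) ^ 4 / ((2 * y * a * F) ^ 2 * b)"
    if "a > 0" "b > 0" "F > 0" "y > 0" for a b f F q y :: real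
    using that by (simp add: divide_simps) (simp add: power_mult_distrib power2_eq_square power4_eq_xxxx)
  from this[of "2 * real n + 1" "2 * real n + 3" "fact (2 * n)" "real n + 1" "16 ^ n" "fact n"]
  have "16 ^ n * fact n ^ 4 / (fact (2 * n) ^ 2 * (2 * real n + 1)) *
        ((4 * (real n + 1) ^ 2) / ((2 * real n + 1) * (2 * real n + 3))) =
      16 ^ Suc n * ((real n + 1) * fact n) ^ 4 /
        (((2 * real n + 2) * (2 * real n + 1) * fact (2 * n)) ^ 2 * (2 * real n + 3))"
    by (simp add: distrib_left)
  ultimately show ?case using Suc.IH by (simp add: add_ac)
qed simp

text \<open>
  In \<open>4 * stirling_remainder n - 2 * stirling_remainder (2 * n)\<close> all growing terms other than
  logarithms of linear functions cancel, which is why Wallis' product determines the limit.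
\<close>

lemma ln_wallis_prod_eq_stirling_remainder:
  assumes "n > 0"
  shows "ln (\<Prod>k=1..n. (4 * real k ^ 2) / (4 * real k ^ 2 - 1)) =
    4 * stirling_remainder n - 2 * stirling_remainder (2 * n)
      + (ln (real n) - ln 2 - ln (2 * real n + 1))"
proof -
  have "ln (16 :: real) = 4 * ln 2"
    using ln_realpow[of 2 4] by simp
  hence "ln (16 ^ n * fact n ^ 4 / (fact (2 * n) ^ 2 * (2 * real n + 1))) =
      4 * real n * ln 2 + 4 * ln (fact n) - 2 * ln (fact (2 * n)) - ln (2 * real n + 1)"
    by (simp add: ln_mult ln_div ln_realpow)
  thus ?thesis
    using assms unfolding wallis_prod_eq_fact stirling_remainder_def
    by (simp add: ln_mult algebra_simps)
qed

lemma stirling_remainder_tendsto: "stirling_remainder \<longlonglongrightarrow> ln (2 * pi) / 2"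
proof -
  have "stirling_remainder (Suc 0) - 1 / (4 * real (Suc 0)) \<le> stirling_remainder (Suc n)" for n
  proof -
    have "1 / (4 * real (Suc n)) \<ge> 0" by simp
    thus ?thesis using incseqD[OF incseq_stirling_remainder, of 0 n] by linarith
  qed
  then obtain S where "(\<lambda>n. stirling_remainder (Suc n)) \<longlonglongrightarrow> S"
    using decseq_convergent[OF decseq_stirling_remainder] by blast
  hence S: "stirling_remainder \<longlonglongrightarrow> S"
    by (rule LIMSEQ_imp_Suc)
  have "(\<lambda>n. stirling_remainder (2 * n)) \<longlonglongrightarrow> S"
    using LIMSEQ_subseq_LIMSEQ[OF S, of "\<lambda>n. 2 * n"] by (simp add: strict_mono_def o_def)
  moreover have "(\<lambda>n. ln (real n) - ln 2 - ln (2 * real n + 1)) \<longlonglongrightarrow> - 2 * ln 2"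
    by real_asymp
  ultimately have "(\<lambda>n. 4 * stirling_remainder n - 2 * stirling_remainder (2 * n)
      + (ln (real n) - ln 2 - ln (2 * real n + 1))) \<longlonglongrightarrow> 4 * S - 2 * S + - 2 * ln 2"
    by (intro tendsto_intros S)
  moreover have "\<forall>\<^sub>F n in sequentially.
      4 * stirling_remainder n - 2 * stirling_remainder (2 * n)
        + (ln (real n) - ln 2 - ln (2 * real n + 1)) =
      ln (\<Prod>k=1..n. (4 * real k ^ 2) / (4 * real k ^ 2 - 1))"
    using eventually_gt_at_top[of 0]
    by eventually_elim (rule ln_wallis_prod_eq_stirling_remainder[symmetric])
  ultimately have "(\<lambda>n. ln (\<Prod>k=1..n. (4 * real k ^ 2) / (4 * real k ^ 2 - 1)))
      \<longlonglongrightarrow> 4 * S - 2 * S + - 2 * ln 2"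
    by (rule Lim_transform_eventually)
  moreover have "(\<lambda>n. ln (\<Prod>k=1..n. (4 * real k ^ 2) / (4 * real k ^ 2 - 1))) \<longlonglongrightarrow> ln (pi / 2)"
    by (intro tendsto_ln wallis) simp
  ultimately have "4 * S - 2 * S + - 2 * ln 2 = ln (pi / 2)"
    by (rule LIMSEQ_unique)
  hence "S = ln (2 * pi) / 2"
    by (simp add: ln_div ln_mult)
  with S show ?thesis by simp
qed

lemma stirling_remainder_bounds:
  assumes "n > 0"
  shows "ln (2 * pi) / 2 \<le> stirling_remainder n"
    and "stirling_remainder n \<le> ln (2 * pi) / 2 + 1 / (4 * real n)"
proof -
  obtain m where n: "n = Suc m" using assms gr0_implies_Suc by blast
  have lim: "(\<lambda>n. stirling_remainder (Suc n)) \<longlonglongrightarrow> ln (2 * pi) / 2"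
    using stirling_remainder_tendsto by (rule LIMSEQ_Suc)
  show "ln (2 * pi) / 2 \<le> stirling_remainder n"
    unfolding n using decseq_ge[OF decseq_stirling_remainder lim] .
  have "(\<lambda>n. 1 / (4 * real (Suc n))) \<longlonglongrightarrow> 0"
    by real_asymp
  from tendsto_diff[OF lim this]
  have "(\<lambda>n. stirling_remainder (Suc n) - 1 / (4 * real (Suc n))) \<longlonglongrightarrow> ln (2 * pi) / 2"
    by simp
  from incseq_le[OF incseq_stirling_remainder this, of m]
  show "stirling_remainder n \<le> ln (2 * pi) / 2 + 1 / (4 * real n)"
    unfolding n by simp
qed

section \<open>Products of the rows of Pascal's triangle\<close>

lemma binomial_row_product_pos: "binomial_row_product n > 0"
  unfolding binomial_row_product_def by (intro prod_pos) auto

text \<open>Multiply the absorption identities \<open>(n + 1 - k) * (n + 1 choose k) = (n + 1) * (n choose k)\<close>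
  over \<open>k \<le> n\<close>; the remaining entry of row \<open>n + 1\<close> is \<open>1\<close>.\<close>

lemma binomial_row_product_Suc:
  "fact (Suc n) * binomial_row_product (Suc n) = Suc n ^ Suc n * binomial_row_product n"
proof -
  have "(\<Prod>k=0..n. Suc n - k) = (fact (Suc n) :: nat)"
    unfolding fact_prod_rev by (simp add: atLeastLessThanSuc_atLeastAtMost)
  hence "fact (Suc n) * binomial_row_product (Suc n) = (\<Prod>k=0..n. (Suc n - k) * (Suc n choose k))"
    by (simp add: binomial_row_product_def prod.distrib)
  also have "\<dots> = (\<Prod>k=0..n. Suc n * (n choose k))"
    by (intro prod.cong refl) (simp only: binomial_absorb_comp diff_Suc_1)
  also have "\<dots> = Suc n ^ Suc n * binomial_row_product n"
    by (simp only: prod.distrib prod_constant binomial_row_product_def) simp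
  finally show ?thesis .
qed

lemma ln_binomial_row_product_Suc:
  "ln (real (binomial_row_product (Suc n))) =
     ln (real (binomial_row_product n)) + real n * ln (real n + 1) - ln (fact n)"
proof -
  have "real (fact (Suc n) * binomial_row_product (Suc n)) =
      real (Suc n ^ Suc n * binomial_row_product n)"
    by (simp only: binomial_row_product_Suc)
  hence "fact (Suc n) * real (binomial_row_product (Suc n)) =
      (real n + 1) ^ Suc n * real (binomial_row_product n)"
    by (simp only: of_nat_mult of_nat_power of_nat_fact of_nat_Suc add.commute)
  from arg_cong[OF this, of ln]
  have "ln (fact (Suc n)) + ln (real (binomial_row_product (Suc n))) =
      real (Suc n) * ln (real n + 1) + ln (real (binomial_row_product n))"
    using binomial_row_product_pos[of n] binomial_row_product_pos[of "Suc n"]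
    by (simp del: fact_Suc power_Suc add: ln_mult ln_realpow)
  thus ?thesis
    unfolding ln_fact_Suc by (simp add: algebra_simps)
qed

definition row_product_error :: "nat \<Rightarrow> real" where
  "row_product_error n = ln (real (binomial_row_product n)) -
      (1 / 2 * real n ^ 2 - 1 / 2 * real n * ln (real n) + (1 - 1 / 2 * ln (2 * pi)) * real n)"

text \<open>
  All terms that do not tend to zero cancel here, and what remains are the three quantities of
  order \<open>1 / n\<close> or smaller: the midpoint-rule error, the increment of \<open>ln\<close>, and the Stirling error.
  The coefficients are forced by \<open>(3 n + 1) / 2 = 3/2 * (n + 1/2) - 1/4\<close>.
\<close>

lemma row_product_error_Suc:
  "row_product_error (Suc n) - row_product_error n =
     3 / 2 * ((real n + 1 / 2) * (ln (real n + 1) - ln (real n)) - 1)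
       - 1 / 4 * (ln (real n + 1) - ln (real n))
       - (stirling_remainder n - ln (2 * pi) / 2)"
  unfolding row_product_error_def stirling_remainder_def ln_binomial_row_product_Suc
  by (simp add: field_simps power2_eq_square)

text \<open>
  Bounding the step by the increment of \<open>ln\<close> rather than by a multiple of \<open>1 / n\<close> avoids harmonic
  sums: the bounds telescope.
\<close>

lemma abs_row_product_error_Suc_le:
  assumes "n > 0"
  shows "\<bar>row_product_error (Suc n) - row_product_error n\<bar> \<le> ln (real n + 1) - ln (real n)"
proof -
  let ?x = "real n" and ?l = "ln (real n + 1) - ln (real n)"
  have x: "?x \<ge> 1" using assms by simp
  have "1 / (?x + 1) \<le> 2 / (2 * ?x + 1)"
    using x by (simp add: field_simps)
  also have "\<dots> \<le> ?l"
    using ln_increment_bounds(1)[OF assms] x by (simp add: field_simps)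
  finally have lower: "1 / (?x + 1) \<le> ?l" .
  have double: "1 / ?x \<le> 2 * (1 / (?x + 1))"
    using x by (simp add: field_simps)
  \<comment> \<open>The estimate is linear in the quantities involved; below, \<open>u = 1 / n\<close> and \<open>v = 1 / (n + 1)\<close>,
     and \<open>p\<close> is the scaled increment of the logarithm.\<close>
  have linear: "\<bar>3 / 2 * (p - 1) - 1 / 4 * l - (r - s)\<bar> \<le> l"
    if "1 \<le> p" "p \<le> 1 + (u / 4 - v / 4)" "s \<le> r" "r \<le> s + u / 4" "v \<le> l" "u \<le> 2 * v"
    for l p r s u v :: real
    using that by argo
  have quarter: "1 / ?x / 4 = 1 / (4 * ?x)" "1 / (?x + 1) / 4 = 1 / (4 * (?x + 1))"
    by simp_all
  show ?thesis
    unfolding row_product_error_Suc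
    using ln_increment_bounds[OF assms] stirling_remainder_bounds[OF assms] lower double
    by (intro linear[where u = "1 / ?x" and v = "1 / (?x + 1)"]) (simp_all only: quarter)
qed

lemma abs_row_product_error_le:
  assumes "n \<ge> 1"
  shows "\<bar>row_product_error n\<bar> \<le> \<bar>row_product_error 1\<bar> + ln (real n)"
  using assms
proof (induction n rule: nat_induct_at_least)
  case (Suc n)
  thus ?case
    using abs_row_product_error_Suc_le[of n] by (simp add: add_ac)
qed simp

theorem theorem3p2:
  shows "\<exists>C::real. \<forall>n::nat. n \<ge> 2 \<longrightarrow>
    \<bar>ln (real (binomial_row_product n)) -
      (1 / 2 * real n ^ 2 - 1 / 2 * real n * ln (real n) + (1 - 1 / 2 * ln (2 * pi)) * real n)\<bar>
    \<le> C * ln (real n)"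
proof (intro exI allI impI)
  fix n :: nat
  assume n: "n \<ge> 2"
  \<comment> \<open>The constant term of the bound is absorbed into the logarithm by \<open>ln 2 \<le> ln n\<close>.\<close>
  let ?A = "\<bar>row_product_error 1\<bar>"
  have "?A = ?A / ln 2 * ln 2" by simp
  also have "\<dots> \<le> ?A / ln 2 * ln (real n)"
    using n by (intro mult_left_mono) auto
  finally have "\<bar>row_product_error n\<bar> \<le> (?A / ln 2 + 1) * ln (real n)"
    using abs_row_product_error_le[of n] n by (simp add: distrib_right)
  thus "\<bar>ln (real (binomial_row_product n)) -
      (1 / 2 * real n ^ 2 - 1 / 2 * real n * ln (real n) + (1 - 1 / 2 * ln (2 * pi)) * real n)\<bar>
    \<le> (\<bar>row_product_error 1\<bar> / ln 2 + 1) * ln (real n)"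
    unfolding row_product_error_def .
qed

end
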